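(* Let $C$ be an $\mathbb{F}_q$-$[n\times m,k,d]$ MRD code and let $\mathcal{M}=\mathcal{M}[C]$. Then $\operatorname{crit}(\mathcal{M})=\left\lceil\frac{n}{m}\right\rceil$ if one of the following holds: (1) $n\le m$; (2) $m<n\le 2m-d$; (3) $k=n=m+1$.
   Context: $q$ is a prime power, $n,m\ge2$. An $\mathbb{F}_q$-$[n\times m,k,d]$ code is a $k$-dimensional $\mathbb{F}_q$-subspace $C\subseteq\mathbb{F}_q^{n\times m}$ with minimum rank distance $d$. $C$ is MRD if $k=\max(n,m)(\min(n,m)-d+1)$ (MRD codes are non-degenerate). $\operatorname{supp}(X)$ is the column space of $X$; $C$ is non-degenerate if $\sum_{X\in C}\operatorname{supp}(X)=\mathbb{F}_q^n$. For non-degenerate $C$, $\operatorname{crit}(\mathcal{M}[C])$ is the least positive integer $t$ such that there exist $X_1,\ldots,X_t\in C$ with $\sum_{i=1}^t\operatorname{supp}(X_i)=\mathbb{F}_q^n$. *)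

theory Defs
  imports "HOL-Analysis.Analysis"
begin

(* A type 'a :: {field, finite} plays the role of the finite field with q = CARD('a) elements,
   and 'a^'m^'n is the space of matrices with n = CARD('n) rows and m = CARD('m) columns. *)

definition mat_scale :: "'a::field \<Rightarrow> 'a^'m^'n \<Rightarrow> 'a^'m^'n" where
  "mat_scale c A = (\<chi> i j. c * A $ i $ j)"

global_interpretation mat_vs: vector_space "mat_scale :: 'a::field \<Rightarrow> 'a^'m^'n \<Rightarrow> 'a^'m^'n"
  by unfold_locales (simp_all add: mat_scale_def vec_eq_iff algebra_simps)

definition mat_supp :: "'a::field^'m^'n \<Rightarrow> ('a^'n) set" where
  "mat_supp X = vec.span (columns X)"

definition rank_distances :: "('a::field^'m^'n) set \<Rightarrow> nat set" where
  "rank_distances C = {rank (X - Y) | X Y. X \<in> C \<and> Y \<in> C \<and> X \<noteq> Y}"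

(* The minimum is required to be attained, so the zero code, which has no minimum distance,
   is not a code with these parameters for any d. *)
definition rank_metric_code ::
  "('a::{field,finite}^'m^'n) set \<Rightarrow> nat \<Rightarrow> nat \<Rightarrow> bool" where
  "rank_metric_code C k d \<longleftrightarrow>
     mat_vs.subspace C \<and> mat_vs.dim C = k \<and>
     d \<in> rank_distances C \<and> (\<forall>e \<in> rank_distances C. d \<le> e)"

(* The subtraction does not truncate: d is the rank of an n x m matrix. *)
definition MRD_code ::
  "('a::{field,finite}^'m^'n) set \<Rightarrow> nat \<Rightarrow> nat \<Rightarrow> bool" where
  "MRD_code C k d \<longleftrightarrow>
     rank_metric_code C k d \<and>
     k = max CARD('n) CARD('m) * (min CARD('n) CARD('m) - d + 1)"

(* The critical exponent of the q-polymatroid of C. The sum is the Minkowski sum of the column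
   spaces, i.e. their sum as subspaces. The value is meaningful for non-degenerate C (the
   supports of all codewords sum to the whole space), since then some such t exists. *)
definition crit :: "('a::{field,finite}^'m^'n) set \<Rightarrow> nat" where
  "crit C = (LEAST t. 0 < t \<and>
     (\<exists>X :: nat \<Rightarrow> 'a^'m^'n. (\<forall>i \<in> {1..t}. X i \<in> C) \<and> (\<Sum>i = 1..t. mat_supp (X i)) = UNIV))"

end

(* Codewords jointly have full support iff no nonzero row vector w annihilates all of them.
   Restricting to suitable rows or columns shows, as in the Singleton bound, that a fixed w
   annihilates at most q^(m(n-d)) codewords, and at most q^((n-1)(m-d+1)) of them. If n <= m,
   an MRD code has q^(m(n-d+1)) elements, more than q^n - 1 annihilator sets of the first size
   can cover, so some codeword has rank n and crit = 1. If n > m, this result for the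
   transposed code gives X of rank m; it is annihilated by only q^(n-m) - 1 nonzero w, and since
   n - m <= m - d + 1 the corresponding sets of the second size do not cover the q^(n(m-d+1))
   codewords, so some Y completes X. Conversely t supports of dimension at most m can only
   sum to a space of dimension at most tm. *)
theory Submission
  imports Defs
begin

section \<open>Cardinality of finite subspaces\<close>

text \<open>By independence, distinct coefficient families on \<open>B\<close> give distinct
  combinations. The families are taken extensional, so that there are exactly
  \<open>CARD('a) ^ card B\<close> of them.\<close>

lemma (in vector_space) card_span:
  assumes "independent B" "finite B"
  shows "card (span B) = CARD('a) ^ card B"
proof -
  let ?f = "\<lambda>u. \<Sum>b\<in>B. scale (u b) b"
  have inj: "inj_on ?f (B \<rightarrow>\<^sub>E UNIV)"
  proof (rule inj_onI)
    fix u v assume u: "u \<in> B \<rightarrow>\<^sub>E UNIV" and v: "v \<in> B \<rightarrow>\<^sub>E UNIV" and eq: "?f u = ?f v"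
    then have "(\<Sum>b\<in>B. scale (u b - v b) b) = 0"
      by (simp add: scale_left_diff_distrib sum_subtractf)
    then have "u b - v b = 0" if "b \<in> B" for b
      by (rule independentD[OF assms order_refl _ that])
    then have "u b = v b" if "b \<in> B" for b
      using that by simp
    then show "u = v"
      by (rule PiE_ext[OF u v])
  qed
  have img: "?f ` (B \<rightarrow>\<^sub>E UNIV) = span B"
  proof -
    \<comment> \<open>\<open>span_finite\<close> lets \<open>u\<close> range over all functions;
      restricting it to \<open>B\<close> leaves the sum unchanged.\<close>
    have "?f u \<in> ?f ` (B \<rightarrow>\<^sub>E UNIV)" for u
    proof (rule image_eqI)
      show "?f u = ?f (restrict u B)"
        by (intro sum.cong) auto
    qed (simp add: restrict_PiE_iff del: restrict_apply)
    then show ?thesis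
      unfolding span_finite[OF assms(2)] by blast
  qed
  have "card (span B) = card (B \<rightarrow>\<^sub>E (UNIV :: 'a set))"
    using card_image[OF inj] unfolding img .
  then show ?thesis
    using assms(2) by (simp add: card_PiE)
qed

lemma (in vector_space) card_subspace:
  assumes "subspace S" "finite S"
  shows "card S = CARD('a) ^ dim S"
proof -
  obtain B where B: "B \<subseteq> S" "independent B" "S \<subseteq> span B" "card B = dim S"
    using basis_exists by blast
  then have "span B = S"
    using assms(1) span_minimal by blast
  moreover have "finite B"
    using B(1) assms(2) finite_subset by blast
  ultimately show ?thesis
    using card_span[OF B(2)] B(4) by metis
qed

section \<open>Rank of matrices over an arbitrary field\<close>

text \<open>Rank factorization: a basis \<open>B\<close> of the column space writes \<open>A\<close>
  as a product with inner dimension \<open>card B\<close>. Read row by row, the same product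
  expresses every row through \<open>card B\<close> vectors.\<close>

lemma dim_rows_le_dim_columns_gen:
  fixes A :: "'a::field^'n^'m"
  shows "vec.dim (rows A) \<le> vec.dim (columns A)"
proof -
  obtain B where B: "B \<subseteq> columns A" "vec.independent B" "columns A \<subseteq> vec.span B"
    "card B = vec.dim (columns A)"
    by (rule vec.basis_exists)
  have finB: "finite B"
    using B(2) by (rule vec.finiteI_independent)
  have "\<exists>u. column j A = (\<Sum>b\<in>B. u b *s b)" for j
  proof -
    have "column j A \<in> vec.span B"
      using B(3) by (auto simp: columns_def)
    then show ?thesis
      unfolding vec.span_finite[OF finB] by (rule rangeE) (rule exI)
  qed
  then obtain u where u: "\<And>j. column j A = (\<Sum>b\<in>B. u j b *s b)"
    by metis
  \<comment> \<open>\<open>v b\<close> collects the coefficients of \<open>b\<close> over all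
    columns; these vectors are the rows of the right factor.\<close>
  define v where "v b = (\<chi> j. u j b)" for b
  have "row i A = (\<Sum>b\<in>B. b $ i *s v b)" for i
  proof -
    have "row i A $ j = column j A $ i" for j
      by (simp add: row_def column_def)
    then show ?thesis
      by (simp add: vec_eq_iff u v_def mult.commute)
  qed
  then have "rows A \<subseteq> vec.span (v ` B)"
    by (auto simp: rows_def intro!: vec.span_sum vec.span_scale intro: vec.span_base)
  then have "vec.dim (rows A) \<le> card (v ` B)"
    using finB vec.dim_le_card by blast
  then show ?thesis
    using card_image_le[OF finB, of v] B(4) by linarith
qed

lemma rank_transpose_gen:
  fixes A :: "'a::field^'n^'m"
  shows "rank (transpose A) = rank A"
  using dim_rows_le_dim_columns_gen[of A] dim_rows_le_dim_columns_gen[of "transpose A"]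
  by (simp add: row_rank_def_gen)

lemma rank_pos:
  fixes A :: "'a::field^'n^'m"
  assumes "A \<noteq> 0"
  shows "0 < rank A"
proof -
  obtain i where i: "row i A \<noteq> 0"
    using assms by (auto simp: vec_eq_iff row_def)
  have "vec.independent {row i A}"
    using i by simp
  moreover have "{row i A} \<subseteq> vec.span (rows A)"
    by (auto simp: rows_def intro: vec.span_base)
  ultimately have "card {row i A} \<le> vec.dim (rows A)"
    using vec.independent_card_le_dim vec.dim_span by metis
  then show ?thesis
    by (simp add: row_rank_def_gen)
qed

text \<open>\<open>rank\<close> is the dimension of the row space, and every row lies in the span of
  the unit vectors indexed by \<open>S\<close>.\<close>

lemma rank_le_nonzero_columns:
  fixes A :: "'a::field^'n^'m"
  assumes "\<And>i j. j \<notin> S \<Longrightarrow> A $ i $ j = 0"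
  shows "rank A \<le> card S"
proof -
  have "row i A \<in> vec.span ((\<lambda>j. axis j 1) ` S)" for i
  proof -
    have "row i A = (\<Sum>j\<in>S. row i A $ j *s axis j 1)"
      using assms by (auto simp: vec_eq_iff row_def axis_def if_distrib cong: if_cong)
    also have "\<dots> \<in> vec.span ((\<lambda>j. axis j 1) ` S)"
      by (auto intro!: vec.span_sum vec.span_scale intro: vec.span_base)
    finally show ?thesis .
  qed
  then have "rows A \<subseteq> vec.span ((\<lambda>j. axis j 1) ` S)"
    by (auto simp: rows_def)
  then have "rank A \<le> card ((\<lambda>j. axis j (1::'a) :: 'a^'n) ` S)"
    unfolding row_rank_def_gen by (intro vec.dim_le_card) auto
  also have "\<dots> \<le> card S"
    by (simp add: card_image_le)
  finally show ?thesis .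
qed

text \<open>Dividing the relation by \<open>w $ i\<close> writes row \<open>i\<close> as a
  combination of the other rows, so the rows indexed by \<open>S\<close> already span the row
  space.\<close>

lemma rank_le_of_row_relation:
  fixes A :: "'a::field^'n^'m"
  assumes w: "w v* A = 0" "w $ i \<noteq> 0"
    and zero: "\<And>r. r \<notin> insert i S \<Longrightarrow> row r A = 0"
  shows "rank A \<le> card S"
proof -
  let ?R = "(\<lambda>r. row r A) ` S"
  have S: "row r A \<in> vec.span ?R" if "r \<noteq> i" for r
    using zero[of r] that by (cases "r \<in> S") (auto intro: vec.span_base simp: vec.span_zero)
  have "(\<Sum>r\<in>UNIV. w $ r *s row r A) = 0"
    using w(1) by (simp add: vector_matrix_mult_def vec_eq_iff row_def)
  then have "w $ i *s row i A = - (\<Sum>r\<in>UNIV - {i}. w $ r *s row r A)"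
    by (simp add: sum.remove[of UNIV i] eq_neg_iff_add_eq_0)
  also have "\<dots> \<in> vec.span ?R"
    using S by (auto intro!: vec.span_neg vec.span_sum vec.span_scale)
  finally have "inverse (w $ i) *s (w $ i *s row i A) \<in> vec.span ?R"
    by (rule vec.span_scale)
  then have "row i A \<in> vec.span ?R"
    using w(2) by simp
  then have "row r A \<in> vec.span ?R" for r
    using S by (cases "r = i") auto
  then have "rows A \<subseteq> vec.span ?R"
    by (auto simp: rows_def)
  then have "rank A \<le> card ?R"
    unfolding row_rank_def_gen by (intro vec.dim_le_card) auto
  also have "\<dots> \<le> card S"
    by (simp add: card_image_le)
  finally show ?thesis .
qed

section \<open>Counting the codewords annihilated by a row vector\<close>

text \<open>The form in which the distance enters the counting: codewords whose difference has rank
  below \<open>d\<close> coincide, so suitable restrictions are injective on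
  \<open>C\<close>.\<close>

definition dist_ge :: "('a::field^'m^'n) set \<Rightarrow> nat \<Rightarrow> bool" where
  "dist_ge C d \<longleftrightarrow> (\<forall>X\<in>C. \<forall>Y\<in>C. X \<noteq> Y \<longrightarrow> d \<le> rank (X - Y))"

lemma dist_ge_transpose:
  assumes "dist_ge C d"
  shows "dist_ge (transpose ` C) d"
proof -
  have "transpose X - transpose Y = transpose (X - Y)" for X Y :: "'a^'b^'c"
    by (simp add: transpose_def vec_eq_iff)
  then show ?thesis
    using assms by (auto simp: dist_ge_def rank_transpose_gen)
qed

text \<open>An annihilated codeword is determined by any \<open>n - d\<close> of its rows other than
  a row \<open>i\<close> with \<open>w $ i \<noteq> 0\<close>: if two agree there, the relation
  given by \<open>w\<close> bounds the rank of their difference by the \<open>d - 1\<close>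
  remaining rows.\<close>

lemma card_annihilated_le_rows:
  fixes C :: "('a::{field,finite}^'m^'n) set"
  assumes "dist_ge C d" "w \<noteq> 0" "0 < d" "d \<le> CARD('n)"
  shows "card {X \<in> C. w v* X = 0} \<le> CARD('a) ^ (CARD('m) * (CARD('n) - d))"
proof -
  obtain i where i: "w $ i \<noteq> 0"
    using assms(2) by (auto simp: vec_eq_iff)
  have "CARD('n) - d \<le> card (UNIV - {i})"
    using assms(3) by (simp add: card_Diff_subset)
  then obtain R where R: "R \<subseteq> UNIV - {i}" "card R = CARD('n) - d"
    using obtain_subset_with_card_n by metis
  \<comment> \<open>The rows neither kept nor equal to \<open>i\<close>; there are
    \<open>d - 1\<close> of them, one less than the distance.\<close>
  define S where "S = UNIV - {i} - R"
  have cardS: "card S < d"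
  proof -
    have "card S = CARD('n) - 1 - (CARD('n) - d)"
      unfolding S_def using R by (simp add: card_Diff_subset)
    then show ?thesis using assms(3,4) by linarith
  qed
  let ?f = "\<lambda>X :: 'a^'m^'n. \<lambda>r\<in>R. row r X"
  have "inj_on ?f {X \<in> C. w v* X = 0}"
  proof (rule inj_onI, rule ccontr)
    fix X Y
    assume X: "X \<in> {X \<in> C. w v* X = 0}" and Y: "Y \<in> {X \<in> C. w v* X = 0}"
      and eq: "?f X = ?f Y" and ne: "X \<noteq> Y"
    have "row r (X - Y) = 0" if "r \<notin> insert i S" for r
    proof -
      have "r \<in> R"
        using that by (auto simp: S_def)
      then have "row r X = row r Y"
        using fun_cong[OF eq, of r] by simp
      then show ?thesis by (simp add: row_def vec_eq_iff)
    qed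
    then have "rank (X - Y) \<le> card S"
      using X Y i by (intro rank_le_of_row_relation[of w]) (auto simp: vector_matrix_mult_diff_rdistrib)
    then show False
      using assms(1) X Y ne cardS by (fastforce simp: dist_ge_def)
  qed
  moreover have "?f ` {X \<in> C. w v* X = 0} \<subseteq> R \<rightarrow>\<^sub>E UNIV"
    by auto
  ultimately have "card {X \<in> C. w v* X = 0} \<le> card (R \<rightarrow>\<^sub>E (UNIV :: ('a^'m) set))"
    by (intro card_inj_on_le) (auto intro: finite_PiE)
  then show ?thesis
    by (simp add: card_PiE R power_mult)
qed

text \<open>An annihilated codeword is determined by \<open>m - d + 1\<close> columns with row
  \<open>i\<close> left out: the relation given by \<open>w\<close> recovers the missing entries,
  and a difference vanishing on these columns has at most \<open>d - 1\<close> nonzero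
  columns.\<close>

lemma card_annihilated_le_columns:
  fixes C :: "('a::{field,finite}^'m^'n) set"
  assumes "dist_ge C d" "w \<noteq> 0" "0 < d" "d \<le> CARD('m)"
  shows "card {X \<in> C. w v* X = 0} \<le> CARD('a) ^ ((CARD('n) - 1) * (CARD('m) - d + 1))"
proof -
  obtain i where i: "w $ i \<noteq> 0"
    using assms(2) by (auto simp: vec_eq_iff)
  have "CARD('m) - d + 1 \<le> CARD('m)"
    using assms(3,4) by linarith
  then obtain S :: "'m set" where S: "card S = CARD('m) - d + 1"
    using obtain_subset_with_card_n by metis
  have cardS: "card (- S) < d"
    using S assms(3,4) by (simp add: Compl_eq_Diff_UNIV card_Diff_subset)
  let ?P = "(UNIV - {i}) \<times> S"
  let ?f = "\<lambda>X :: 'a^'m^'n. \<lambda>(r, j)\<in>?P. X $ r $ j"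
  have "inj_on ?f {X \<in> C. w v* X = 0}"
  proof (rule inj_onI, rule ccontr)
    fix X Y
    assume X: "X \<in> {X \<in> C. w v* X = 0}" and Y: "Y \<in> {X \<in> C. w v* X = 0}"
      and eq: "?f X = ?f Y" and ne: "X \<noteq> Y"
    have off: "(X - Y) $ r $ j = 0" if "j \<in> S" "r \<noteq> i" for r j
      using fun_cong[OF eq, of "(r, j)"] that by simp
    have "(X - Y) $ i $ j = 0" if "j \<in> S" for j
    proof -
      have "w v* (X - Y) = 0"
        using X Y by (simp add: vector_matrix_mult_diff_rdistrib)
      then have "(\<Sum>r\<in>UNIV. w $ r * (X - Y) $ r $ j) = 0"
        by (simp add: vector_matrix_mult_def vec_eq_iff)
      \<comment> \<open>All summands with \<open>r \<noteq> i\<close> vanish, since the two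
        codewords agree off row \<open>i\<close>.\<close>
      moreover have "(\<Sum>r\<in>UNIV. w $ r * (X - Y) $ r $ j) = w $ i * (X - Y) $ i $ j"
        using off[OF that] by (subst sum.remove[of _ i]) (auto intro!: sum.neutral)
      ultimately show ?thesis
        using i by simp
    qed
    then have "rank (X - Y) \<le> card (- S)"
      using off by (intro rank_le_nonzero_columns) (metis ComplI)
    then show False
      using assms(1) X Y ne cardS by (fastforce simp: dist_ge_def)
  qed
  moreover have "?f ` {X \<in> C. w v* X = 0} \<subseteq> ?P \<rightarrow>\<^sub>E UNIV"
    by (auto split: if_splits)
  ultimately have "card {X \<in> C. w v* X = 0} \<le> card (?P \<rightarrow>\<^sub>E (UNIV :: 'a set))"
    by (intro card_inj_on_le) (auto intro: finite_PiE)
  then show ?thesis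
    by (simp add: card_PiE S card_cartesian_product card_Diff_subset)
qed

section \<open>Codewords with trivial left kernel\<close>

text \<open>Union bound: otherwise the annihilated sets for \<open>w \<in> W\<close> would cover
  \<open>C\<close>.\<close>

lemma exists_not_annihilated:
  fixes C :: "('a::{field,finite}^'m^'n) set"
  assumes bound: "\<And>w. w \<in> W \<Longrightarrow> card {X \<in> C. w v* X = 0} \<le> b"
    and less: "card W * b < card C"
  shows "\<exists>X\<in>C. \<forall>w\<in>W. w v* X \<noteq> 0"
proof (rule ccontr)
  assume "\<not> ?thesis"
  then have "C \<subseteq> (\<Union>w\<in>W. {X \<in> C. w v* X = 0})"
    by auto
  then have "card C \<le> card (\<Union>w\<in>W. {X \<in> C. w v* X = 0})"
    by (rule card_mono[rotated]) simp
  also have "\<dots> \<le> (\<Sum>w\<in>W. card {X \<in> C. w v* X = 0})"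
    by (rule card_UN_le) simp
  also have "\<dots> \<le> card W * b"
    using sum_bounded_above[of W _ b] bound by simp
  finally show False
    using less by simp
qed

lemma exists_full_row_rank:
  fixes C :: "('a::{field,finite}^'m^'n) set"
  assumes "dist_ge C d" "0 < d" "d \<le> CARD('n)" "CARD('n) \<le> CARD('m)"
    and card: "card C = CARD('a) ^ (CARD('m) * (CARD('n) - d + 1))"
  shows "\<exists>X\<in>C. \<forall>w. w v* X = 0 \<longrightarrow> w = 0"
proof -
  have q: "0 < CARD('a)" by simp
  have "card (UNIV - {0 :: 'a^'n}) < CARD('a) ^ CARD('n)"
    by (simp add: card_Diff_subset)
  also have "\<dots> \<le> CARD('a) ^ CARD('m)"
    using assms(4) q by (intro power_increasing) auto
  \<comment> \<open>\<open>card C\<close> is exactly \<open>CARD('a) ^ CARD('m)\<close> times the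
    bound for a single \<open>w\<close>, and there are fewer nonzero \<open>w\<close> than
    that.\<close>
  finally have "card (UNIV - {0 :: 'a^'n}) * CARD('a) ^ (CARD('m) * (CARD('n) - d)) < card C"
    unfolding card by (simp add: power_add)
  then have "\<exists>X\<in>C. \<forall>w\<in>UNIV - {0}. w v* X \<noteq> 0"
    using card_annihilated_le_rows[OF assms(1) _ assms(2,3)]
    by (intro exists_not_annihilated) auto
  then show ?thesis by blast
qed

text \<open>The left inverse makes \<open>y \<mapsto> y v* B\<close> a section of
  \<open>w \<mapsto> w v* X\<close>, so translating the kernel by its values gives disjoint copies,
  one for each \<open>y\<close>. The product form avoids the exponent \<open>n - m\<close>.\<close>

lemma card_left_kernel_le:
  fixes X :: "'a::{field,finite}^'m^'n"
  assumes "B ** X = mat 1"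
  shows "card {w. w v* X = 0} * CARD('a) ^ CARD('m) \<le> CARD('a) ^ CARD('n)"
proof -
  let ?K = "{w. w v* X = 0}"
  let ?f = "\<lambda>(w, y). w + y v* B"
  have "(w + y v* B) v* X = y" if "w \<in> ?K" for w y
    using that assms by (simp add: vector_matrix_left_distrib vector_matrix_mul_assoc)
  then have "inj_on ?f (?K \<times> UNIV)"
    by (intro inj_onI) (clarsimp, metis add_right_cancel)
  then have "card (?K \<times> (UNIV :: ('a^'m) set)) \<le> card (UNIV :: ('a^'n) set)"
    by (rule card_inj_on_le) auto
  then show ?thesis
    by (simp add: card_cartesian_product)
qed

text \<open>The bound on \<open>CARD('n)\<close> says \<open>n - m \<le> m - d + 1\<close>. It
  exceeds condition (2) by one, so that \<open>n = m + 1\<close> is covered as well.\<close>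

lemma exists_two_jointly_full:
  fixes C :: "('a::{field,finite}^'m^'n) set"
  assumes "dist_ge C d" "0 < d" "d \<le> CARD('m)"
    and n: "CARD('m) < CARD('n)" "CARD('n) \<le> 2 * CARD('m) - d + 1"
    and card: "card C = CARD('a) ^ (CARD('n) * (CARD('m) - d + 1))"
  shows "\<exists>X\<in>C. \<exists>Y\<in>C. \<forall>w. w v* X = 0 \<longrightarrow> w v* Y = 0 \<longrightarrow> w = 0"
proof -
  let ?q = "CARD('a)"
  let ?n = "CARD('n)" let ?m = "CARD('m)"
  have "inj (transpose :: 'a^'m^'n \<Rightarrow> _)"
    by (metis injI transpose_transpose)
  then have "card (transpose ` C) = ?q ^ (?n * (?m - d + 1))"
    using card by (simp add: card_image inj_on_subset)
  \<comment> \<open>Transposition swaps \<open>n\<close> and \<open>m\<close>, so the transposed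
    code has fewer rows than columns; full row rank of \<open>transpose X\<close> makes
    \<open>X\<close> left invertible.\<close>
  then obtain X where X: "X \<in> C" "\<And>v. v v* transpose X = 0 \<Longrightarrow> v = 0"
    using exists_full_row_rank[OF dist_ge_transpose[OF assms(1)]] assms(2,3) n(1) by fastforce
  then obtain B where B: "B ** X = mat 1"
    using matrix_left_invertible_ker[of X] by auto
  define W where "W = {w. w v* X = 0} - {0}"
  have "card {w. w v* X = 0} * ?q ^ ?m \<le> ?q ^ (?n - ?m) * ?q ^ ?m"
    using card_left_kernel_le[OF B] n(1) by (simp flip: power_add)
  then have "card {w. w v* X = 0} \<le> ?q ^ (?n - ?m)"
    by simp
  \<comment> \<open>Removing 0 makes the estimate strict, which is what admits the boundary case
    \<open>n - m = m - d + 1\<close>.\<close>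
  moreover have "card W < card {w. w v* X = 0}"
    unfolding W_def by (rule card_Diff1_less) auto
  moreover have "?q ^ (?n - ?m) \<le> ?q ^ (?m - d + 1)"
    using n assms(3) by (intro power_increasing) auto
  ultimately have "card W < ?q ^ (?m - d + 1)"
    by linarith
  then have "card W * ?q ^ ((?n - 1) * (?m - d + 1))
      < ?q ^ (?m - d + 1) * ?q ^ ((?n - 1) * (?m - d + 1))"
    by simp
  also have "\<dots> = card C"
    unfolding card power_add[symmetric] using mult_eq_if[of ?n "?m - d + 1"] by simp
  finally have "\<exists>Y\<in>C. \<forall>w\<in>W. w v* Y \<noteq> 0"
    using card_annihilated_le_columns[OF assms(1) _ assms(2,3)]
    by (intro exists_not_annihilated) (auto simp: W_def)
  then show ?thesis
    using X(1) by (auto simp: W_def)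
qed

section \<open>Supports and their sums\<close>

lemma mat_supp_eq_range: "mat_supp X = range ((*v) X)"
proof
  have "column j X = X *v axis j 1" for j
    by (simp add: column_def matrix_vector_mult_def axis_def vec_eq_iff if_distrib cong: if_cong)
  then have "columns X \<subseteq> range ((*v) X)"
    by (auto simp: columns_def)
  moreover have "vec.subspace (range ((*v) X))"
    by (simp add: vec.subspace_image)
  ultimately show "mat_supp X \<subseteq> range ((*v) X)"
    unfolding mat_supp_def by (rule vec.span_minimal)
  show "range ((*v) X) \<subseteq> mat_supp X"
    using matrix_vector_mult_in_columnspace_gen by (auto simp: mat_supp_def)
qed

lemma card_mat_supp_le:
  fixes X :: "'a::{field,finite}^'m^'n"
  shows "card (mat_supp X) \<le> CARD('a) ^ CARD('m)"
  unfolding mat_supp_eq_range using card_image_le[of UNIV "(*v) X"] by simp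

text \<open>Full column space means right invertible, that is, \<open>transpose X\<close> is left
  invertible and so has trivial kernel; this is the left kernel of \<open>X\<close>.\<close>

lemma mat_supp_eq_UNIV_iff: "mat_supp X = UNIV \<longleftrightarrow> (\<forall>w. w v* X = 0 \<longrightarrow> w = 0)"
  using matrix_right_invertible_span_columns[of X] left_invertible_transpose[of X]
    matrix_left_invertible_ker[of "transpose X"]
  by (simp add: mat_supp_def)

text \<open>Place \<open>X\<close> and \<open>Y\<close> side by side: the left kernel of the block
  matrix is the intersection of the two left kernels, and its column space is the sum of the
  supports.\<close>

lemma mat_supp_add_eq_UNIV:
  fixes X Y :: "'a::field^'m^'n"
  assumes "\<And>w. w v* X = 0 \<Longrightarrow> w v* Y = 0 \<Longrightarrow> w = 0"
  shows "mat_supp X + mat_supp Y = UNIV"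
proof -
  \<comment> \<open>The sum type \<open>'m + 'm\<close> indexes the columns of the block
    matrix.\<close>
  define Z :: "'a^('m + 'm)^'n" where
    "Z = (\<chi> i j. case j of Inl k \<Rightarrow> X $ i $ k | Inr k \<Rightarrow> Y $ i $ k)"
  have "w = 0" if "w v* Z = 0" for w
  proof (rule assms)
    have Z: "(\<Sum>i\<in>UNIV. w $ i * Z $ i $ j) = 0" for j
      using that by (simp add: vector_matrix_mult_def vec_eq_iff)
    show "w v* X = 0" "w v* Y = 0"
      using Z[of "Inl _"] Z[of "Inr _"] by (simp_all add: Z_def vector_matrix_mult_def vec_eq_iff)
  qed
  then have "mat_supp Z = UNIV"
    by (simp add: mat_supp_eq_UNIV_iff)
  moreover have "columns Z = columns X \<union> columns Y"
  proof -
    have "column (Inl k) Z = column k X" "column (Inr k) Z = column k Y" for k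
      by (simp_all add: Z_def column_def vec_eq_iff)
    then show ?thesis
      by (auto simp: columns_def) (metis sum.exhaust, metis+)
  qed
  moreover have "mat_supp X + mat_supp Y = vec.span (columns X \<union> columns Y)"
    by (auto simp: mat_supp_def vec.span_Un set_plus_def)
  ultimately show ?thesis
    by (simp add: mat_supp_def)
qed

lemma card_set_plus_le:
  assumes "finite A" "finite B"
  shows "card (A + B) \<le> card A * card B"
proof -
  have "A + B = (\<lambda>(a, b). a + b) ` (A \<times> B)"
    by (auto simp: set_plus_def)
  then show ?thesis
    using card_image_le[of "A \<times> B" "\<lambda>(a, b). a + b"] assms by (simp add: card_cartesian_product)
qed

text \<open>Subadditivity of dimension, carried out with cardinalities: the sum has at most
  \<open>CARD('a) ^ (t * CARD('m))\<close> elements.\<close>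

lemma le_of_sum_mat_supp_eq_UNIV:
  fixes X :: "nat \<Rightarrow> 'a::{field,finite}^'m^'n"
  assumes "(\<Sum>i = 1..t. mat_supp (X i)) = UNIV"
  shows "CARD('n) \<le> t * CARD('m)"
proof -
  have "card (\<Sum>i\<in>I. mat_supp (X i)) \<le> CARD('a) ^ (card I * CARD('m))" if "finite I" for I
    using that
  proof induction
    case empty
    \<comment> \<open>The empty Minkowski sum is \<open>{0}\<close>, with one element.\<close>
    then show ?case by (simp add: set_zero)
  next
    case (insert i I)
    have "card (mat_supp (X i) + (\<Sum>i\<in>I. mat_supp (X i)))
        \<le> card (mat_supp (X i)) * card (\<Sum>i\<in>I. mat_supp (X i))"
      by (rule card_set_plus_le) auto
    also have "\<dots> \<le> CARD('a) ^ CARD('m) * CARD('a) ^ (card I * CARD('m))"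
      by (intro mult_mono card_mat_supp_le insert.IH) auto
    finally show ?case
      using insert.hyps by (simp add: power_add)
  qed
  from this[of "{1..t}"] have "CARD('a) ^ CARD('n) \<le> CARD('a) ^ (t * CARD('m))"
    using assms by simp
  moreover have "1 < CARD('a)"
  proof -
    have "card {0, 1 :: 'a} \<le> CARD('a)"
      by (rule card_mono) auto
    then show ?thesis by simp
  qed
  ultimately show ?thesis
    by (simp add: power_increasing_iff)
qed

section \<open>Evaluation of the critical exponent\<close>

text \<open>The witness forces \<open>n \<le> t * m\<close>. Together with
  \<open>(t - 1) * m < n\<close> this fixes the ceiling, and it rules out fewer than
  \<open>t\<close> supports.\<close>

lemma crit_eq_ceiling:
  fixes C :: "('a::{field,finite}^'m^'n) set"
  assumes "\<And>i. i \<in> {1..t} \<Longrightarrow> X i \<in> C" "(\<Sum>i = 1..t. mat_supp (X i)) = UNIV"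
    and "0 < t" and min: "(t - 1) * CARD('m) < CARD('n)"
  shows "int (crit C) = \<lceil>real CARD('n) / real CARD('m)\<rceil>"
proof -
  have "crit C = t"
    unfolding crit_def
  proof (rule Least_equality)
    show "0 < t \<and> (\<exists>X. (\<forall>i\<in>{1..t}. X i \<in> C) \<and> (\<Sum>i = 1..t. mat_supp (X i)) = UNIV)"
      using assms by blast
  next
    fix s :: nat
    assume "0 < s \<and> (\<exists>X :: nat \<Rightarrow> 'a^'m^'n. (\<forall>i\<in>{1..s}. X i \<in> C) \<and> (\<Sum>i = 1..s. mat_supp (X i)) = UNIV)"
    then have "CARD('n) \<le> s * CARD('m)"
      using le_of_sum_mat_supp_eq_UNIV by blast
    then have "(t - 1) * CARD('m) < s * CARD('m)"
      using min by linarith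
    then show "t \<le> s"
      by simp
  qed
  moreover have "\<lceil>real CARD('n) / real CARD('m)\<rceil> = int t"
  proof (rule ceiling_unique)
    have "real ((t - 1) * CARD('m)) < real CARD('n)"
      using min by (simp only: of_nat_less_iff)
    then show "real_of_int (int t) - 1 < real CARD('n) / real CARD('m)"
      using assms(3) by (simp add: field_simps of_nat_diff)
    have "real CARD('n) \<le> real (t * CARD('m))"
      using le_of_sum_mat_supp_eq_UNIV[OF assms(2)] by (simp only: of_nat_le_iff)
    then show "real CARD('n) / real CARD('m) \<le> real_of_int (int t)"
      by (simp add: field_simps)
  qed
  ultimately show ?thesis by simp
qed

theorem theorem5p8:
  fixes C :: "('a::{field,finite}^'m^'n) set" and k d :: nat
  assumes "CARD('n) \<ge> 2" and "CARD('m) \<ge> 2"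
    and "MRD_code C k d"
    and "CARD('n) \<le> CARD('m)
       \<or> (CARD('m) < CARD('n) \<and> CARD('n) \<le> 2 * CARD('m) - d)
       \<or> (k = CARD('n) \<and> CARD('n) = CARD('m) + 1)"
  shows "int (crit C) = \<lceil>real CARD('n) / real CARD('m)\<rceil>"
proof -
  have sub: "mat_vs.subspace C" and dim: "mat_vs.dim C = k"
    and d: "d \<in> rank_distances C" "\<forall>e\<in>rank_distances C. d \<le> e"
    and k: "k = max CARD('n) CARD('m) * (min CARD('n) CARD('m) - d + 1)"
    using assms(3) by (auto simp: MRD_code_def rank_metric_code_def)
  have dist: "dist_ge C d"
    using d(2) by (auto simp: dist_ge_def rank_distances_def)
  have card: "card C = CARD('a) ^ k"
    using mat_vs.card_subspace[OF sub] dim by simp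
  \<comment> \<open>As the minimum distance is attained, \<open>d\<close> is the rank of a nonzero
    matrix; hence \<open>1 \<le> d \<le> min n m\<close>, as the counting requires.\<close>
  obtain A :: "'a^'m^'n" where A: "d = rank A" "A \<noteq> 0"
    using d(1) by (auto simp: rank_distances_def)
  have d_pos: "0 < d"
    using A rank_pos by blast
  have d_le_m: "d \<le> CARD('m)"
    using A(1) rank_le_nonzero_columns[of UNIV A] by simp
  have d_le_n: "d \<le> CARD('n)"
    using A(1) rank_le_nonzero_columns[of UNIV "transpose A"] by (simp add: rank_transpose_gen)
  show ?thesis
  proof (cases "CARD('n) \<le> CARD('m)")
    case True
    then obtain X where "X \<in> C" "mat_supp X = UNIV"
      using exists_full_row_rank[OF dist d_pos d_le_n True] card k
      by (auto simp: mat_supp_eq_UNIV_iff)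
    then show ?thesis
      by (intro crit_eq_ceiling[of 1 "\<lambda>_. X"]) auto
  next
    case False
    then have less: "CARD('m) < CARD('n)"
      by simp
    moreover have "CARD('n) \<le> 2 * CARD('m) - d + 1"
      \<comment> \<open>If \<open>n = m + 1\<close>, this is just \<open>d \<le> m\<close>.\<close>
      using assms(4) False d_le_m by auto
    moreover have "card C = CARD('a) ^ (CARD('n) * (CARD('m) - d + 1))"
      using card k less by (simp add: max_def min_def)
    ultimately obtain X Y where XY: "X \<in> C" "Y \<in> C"
      "\<And>w. w v* X = 0 \<Longrightarrow> w v* Y = 0 \<Longrightarrow> w = 0"
      using exists_two_jointly_full[OF dist d_pos d_le_m] by blast
    have "mat_supp X + mat_supp Y = UNIV"
      using XY(3) by (rule mat_supp_add_eq_UNIV)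
    then have "(\<Sum>i = 1..2 :: nat. mat_supp (if i = 1 then X else Y)) = UNIV"
      by (simp add: numeral_2_eq_2 add.commute)
    then show ?thesis
      \<comment> \<open>For \<open>t = 2\<close> the minimality condition is \<open>m < n\<close>:
        one support is too small.\<close>
      using XY less by (intro crit_eq_ceiling[of 2 "\<lambda>i. if i = 1 then X else Y"]) auto
  qed
qed

end
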